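(* Let $X$ be a locale, let $R$ be a localic relation on $X$ with open cones, and let $\mathsf{u},\mathsf{d}\colon\mathcal{O}X\to\mathcal{O}X$ be a join-preserving parallel pair (i.e. $(\mathcal{O}X,\mathsf{u},\mathsf{d})$ is a conic frame). Then $R\subseteq R_{\mathsf{u},\mathsf{d}}$ if and only if $\Uparrow_R\sqsubseteq\mathsf{u}$ and $\Downarrow_R\sqsubseteq\mathsf{d}$ (pointwise).
   Context: Frames and locales. A frame is a complete lattice (order $\sqsubseteq$) in which $x\wedge\bigvee y_i=\bigvee (x\wedge y_i)$; frame maps preserve finite meets and all joins. The category of locales is the opposite of the category of frames: a locale $X$ has a frame of opens $\mathcal{O}X$, and a map $f\colon X\to Y$ is a frame map $f^{-1}\colon\mathcal{O}Y\to\mathcal{O}X$. $L\otimes M$ is the coproduct of frames, generated under joins by the rectangles $x\otimes y=\iota_1(x)\wedge\iota_2(y)$ ($\iota_1,\iota_2$ the coproduct injections); $\mathcal{O}(X\times Y)=\mathcal{O}X\otimes\mathcal{O}Y$. A sublocale of $X$ is (an isomorphism class of) an extremal monomorphism $A\rightarrowtail X$, equivalently a map whose frame map is surjective; $A\subseteq B$ means the inclusion of $A$ factors through that of $B$. Open cone relations. A localic relation on $X$ is a sublocale $r\colon R\rightarrowtail X\times X$; its source and target maps are $s=\mathrm{pr}_1\circ r$, $t=\mathrm{pr}_2\circ r\colon R\to X$. A locale map $f\colon X\to Y$ is open if $f^{-1}$ has a left adjoint $f_!$ with $f_!(U\wedge f^{-1}(V))=f_!(U)\wedge V$. $R$ has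 open cones if $s,t$ are open; then its induced cones are $\Uparrow_R:=t_!s^{-1}$ and $\Downarrow_R:=s_!t^{-1}\colon\mathcal{O}X\to\mathcal{O}X$. Parallel pairs and induced relation. Functions $\mathsf{u},\mathsf{d}\colon L\to L$ on a frame are parallel if $\mathsf{u}(x)\wedge y\sqsubseteq\mathsf{u}(x\wedge\mathsf{d}(y))$ and $x\wedge\mathsf{d}(y)\sqsubseteq\mathsf{d}(\mathsf{u}(x)\wedge y)$ for all $x,y\in L$. Given such a join-preserving pair on $\mathcal{O}X$, let $\sim$ be the binary relation on rectangles of $\mathcal{O}X\otimes\mathcal{O}X$ with $a\otimes b\sim c\otimes d$ iff $\mathsf{u}(a)\wedge b=\mathsf{u}(c)\wedge d$ and $a\wedge\mathsf{d}(b)=c\wedge\mathsf{d}(d)$. An element $o\in\mathcal{O}X\otimes\mathcal{O}X$ is $\sim$-saturated if for all $p\sim q$ and all $w$: $p\wedge w\sqsubseteq o$ iff $q\wedge w\sqsubseteq o$. $R_{\mathsf{u},\mathsf{d}}\rightarrowtail X\times X$ is the sublocale whose frame is the set of $\sim$-saturated elements, with frame map $\mu_\sim(o)=$ the least $\sim$-saturated element above $o$; equivalently, the quotient of $\mathcal{O}X\otimes\mathcal{O}X$ by the frame congruence generated by $\sim$. *)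

theory Defs
  imports Complex_Main "HOL-Library.Lub_Glb"
begin

section \<open>Frames and frame maps\<close>

text \<open>The library class \<^class>\<open>complete_distrib_lattice\<close> demands complete distributivity, which is
  stronger than the frame law.\<close>

class frame = complete_lattice +
  assumes inf_Sup_frame: "inf x (Sup Y) = Sup (inf x ` Y)"

text \<open>
  The frame of a sublocale such as the one induced by a parallel pair is a subset of another
  frame whose joins are not the ambient ones. Frame maps are therefore defined between subsets
  \<open>A\<close>, \<open>B\<close> of ordered types, with joins and meets computed within these subsets.
\<close>

definition frame_map_on :: "'a::order set \<Rightarrow> 'b::order set \<Rightarrow> ('a \<Rightarrow> 'b) \<Rightarrow> bool" where
  "frame_map_on A B f \<longleftrightarrow>
     f ` A \<subseteq> B \<and>
     (\<forall>S x. S \<subseteq> A \<longrightarrow> isLub A S x \<longrightarrow> isLub B (f ` S) (f x)) \<and>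
     (\<forall>S x. S \<subseteq> A \<longrightarrow> finite S \<longrightarrow> isGlb A S x \<longrightarrow> isGlb B (f ` S) (f x))"

abbreviation frame_map :: "('a::order \<Rightarrow> 'b::order) \<Rightarrow> bool" where
  "frame_map \<equiv> frame_map_on UNIV UNIV"

lemma isLub_iff_le: "isLub A S x \<longleftrightarrow> x \<in> A \<and> (\<forall>y\<in>A. x \<le> y \<longleftrightarrow> (\<forall>s\<in>S. s \<le> y))" for x :: "'a::order"
  unfolding isLub_def leastP_def isUb_def setle_def setge_def by (auto intro: order_trans)

lemma isGlb_iff_le: "isGlb A S x \<longleftrightarrow> x \<in> A \<and> (\<forall>y\<in>A. y \<le> x \<longleftrightarrow> (\<forall>s\<in>S. y \<le> s))" for x :: "'a::order"
  unfolding isGlb_def greatestP_def isLb_def setle_def setge_def by (auto intro: order_trans)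

lemma isLub_UNIV_iff: "isLub UNIV S x \<longleftrightarrow> x = Sup S" for x :: "'a::complete_lattice"
  unfolding isLub_iff_le by (auto simp flip: Sup_le_iff intro: order_antisym)

lemma isGlb_UNIV_iff: "isGlb UNIV S x \<longleftrightarrow> x = Inf S" for x :: "'a::complete_lattice"
  unfolding isGlb_iff_le by (auto simp flip: le_Inf_iff intro: order_antisym)

lemma frame_map_iff:
  "frame_map f \<longleftrightarrow> f top = top \<and> (\<forall>x y. f (inf x y) = inf (f x) (f y)) \<and> (\<forall>S. f (Sup S) = Sup (f ` S))"
  for f :: "'a::complete_lattice \<Rightarrow> 'b::complete_lattice"
proof
  assume f: "frame_map f"
  have "f (Inf S) = Inf (f ` S)" if "finite S" for S
    using f that unfolding frame_map_on_def by (simp add: isGlb_UNIV_iff)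
  from this[of "{}"] this[of "{x, y}" for x y] f
  show "f top = top \<and> (\<forall>x y. f (inf x y) = inf (f x) (f y)) \<and> (\<forall>S. f (Sup S) = Sup (f ` S))"
    unfolding frame_map_on_def by (simp add: isLub_UNIV_iff)
next
  assume f: "f top = top \<and> (\<forall>x y. f (inf x y) = inf (f x) (f y)) \<and> (\<forall>S. f (Sup S) = Sup (f ` S))"
  have "f (Inf S) = Inf (f ` S)" if "finite S" for S
    using that f by (induction S rule: finite_induct) simp_all
  with f show "frame_map f"
    unfolding frame_map_on_def by (simp add: isLub_UNIV_iff isGlb_UNIV_iff)
qed


section \<open>The coproduct of two frames\<close>

text \<open>
  The coproduct is realised by the down-closed sets of pairs that are closed under joins in each
  coordinate separately; \<open>coprod_universal\<close> below is its universal property.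
\<close>

definition coprod_ideal :: "('a::complete_lattice \<times> 'b::complete_lattice) set \<Rightarrow> bool" where
  "coprod_ideal I \<longleftrightarrow>
     (\<forall>a b a' b'. (a, b) \<in> I \<longrightarrow> a' \<le> a \<longrightarrow> b' \<le> b \<longrightarrow> (a', b') \<in> I) \<and>
     (\<forall>S b. (\<forall>a\<in>S. (a, b) \<in> I) \<longrightarrow> (Sup S, b) \<in> I) \<and>
     (\<forall>a T. (\<forall>b\<in>T. (a, b) \<in> I) \<longrightarrow> (a, Sup T) \<in> I)"

typedef (overloaded) ('a::frame, 'b::frame) frame_coprod = "{I :: ('a \<times> 'b) set. coprod_ideal I}"
  by (rule exI[of _ UNIV]) (simp add: coprod_ideal_def)

setup_lifting type_definition_frame_coprod

lemma coprod_ideal_down: "coprod_ideal I \<Longrightarrow> (a, b) \<in> I \<Longrightarrow> a' \<le> a \<Longrightarrow> b' \<le> b \<Longrightarrow> (a', b') \<in> I"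
  and coprod_ideal_Sup1: "coprod_ideal I \<Longrightarrow> (\<And>a. a \<in> S \<Longrightarrow> (a, b) \<in> I) \<Longrightarrow> (Sup S, b) \<in> I"
  and coprod_ideal_Sup2: "coprod_ideal I \<Longrightarrow> (\<And>b. b \<in> T \<Longrightarrow> (a, b) \<in> I) \<Longrightarrow> (a, Sup T) \<in> I"
  unfolding coprod_ideal_def by simp_all

lemma coprod_ideal_bot1: "coprod_ideal I \<Longrightarrow> (bot, b) \<in> I"
  and coprod_ideal_bot2: "coprod_ideal I \<Longrightarrow> (a, bot) \<in> I"
  using coprod_ideal_Sup1[of I "{}"] coprod_ideal_Sup2[of I "{}"] by simp_all

lemma coprod_ideal_Inter: "(\<And>I. I \<in> \<I> \<Longrightarrow> coprod_ideal I) \<Longrightarrow> coprod_ideal (\<Inter>\<I>)"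
  unfolding coprod_ideal_def by simp meson

instantiation frame_coprod :: (frame, frame) complete_lattice
begin

lift_definition less_eq_frame_coprod :: "('a, 'b) frame_coprod \<Rightarrow> ('a, 'b) frame_coprod \<Rightarrow> bool"
  is "(\<subseteq>)" .

lift_definition less_frame_coprod :: "('a, 'b) frame_coprod \<Rightarrow> ('a, 'b) frame_coprod \<Rightarrow> bool"
  is "(\<subset>)" .

lift_definition Inf_frame_coprod :: "('a, 'b) frame_coprod set \<Rightarrow> ('a, 'b) frame_coprod"
  is "\<lambda>\<I>. \<Inter>\<I>" by (rule coprod_ideal_Inter) blast

lift_definition inf_frame_coprod ::
    "('a, 'b) frame_coprod \<Rightarrow> ('a, 'b) frame_coprod \<Rightarrow> ('a, 'b) frame_coprod"
  is "(\<inter>)" subgoal for I J using coprod_ideal_Inter[of "{I, J}"] by auto done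

lift_definition top_frame_coprod :: "('a, 'b) frame_coprod"
  is UNIV by (simp add: coprod_ideal_def)

definition Sup_frame_coprod :: "('a, 'b) frame_coprod set \<Rightarrow> ('a, 'b) frame_coprod" where
  "Sup_frame_coprod A = Inf {z. \<forall>x\<in>A. x \<le> z}"

definition sup_frame_coprod ::
    "('a, 'b) frame_coprod \<Rightarrow> ('a, 'b) frame_coprod \<Rightarrow> ('a, 'b) frame_coprod" where
  "sup_frame_coprod x y = Inf {z. x \<le> z \<and> y \<le> z}"

definition bot_frame_coprod :: "('a, 'b) frame_coprod" where
  "bot_frame_coprod = Inf UNIV"

instance
proof -
  have Inf_le: "Inf A \<le> x" if "x \<in> A" for A and x :: "('a, 'b) frame_coprod"
    using that by transfer blast
  have le_Inf: "z \<le> Inf A" if "\<And>x. x \<in> A \<Longrightarrow> z \<le> x" for A and z :: "('a, 'b) frame_coprod"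
    using that by transfer blast
  show "OFCLASS(('a, 'b) frame_coprod, complete_lattice_class)"
  proof
    fix x y z :: "('a, 'b) frame_coprod" and A :: "('a, 'b) frame_coprod set"
    show "x < y \<longleftrightarrow> x \<le> y \<and> \<not> y \<le> x" by transfer blast
    show "x \<le> x" by transfer blast
    show "x \<le> y \<Longrightarrow> y \<le> z \<Longrightarrow> x \<le> z" by transfer blast
    show "x \<le> y \<Longrightarrow> y \<le> x \<Longrightarrow> x = y" by transfer blast
    show "inf x y \<le> x" "inf x y \<le> y" by (transfer, blast)+
    show "x \<le> y \<Longrightarrow> x \<le> z \<Longrightarrow> x \<le> inf y z" by transfer blast
    show "x \<le> sup x y" "y \<le> sup x y" by (auto simp: sup_frame_coprod_def intro: le_Inf)
    show "y \<le> x \<Longrightarrow> z \<le> x \<Longrightarrow> sup y z \<le> x" by (auto simp: sup_frame_coprod_def intro: Inf_le)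
    show "x \<in> A \<Longrightarrow> Inf A \<le> x" by (rule Inf_le)
    show "(\<And>x. x \<in> A \<Longrightarrow> z \<le> x) \<Longrightarrow> z \<le> Inf A" by (rule le_Inf)
    show "x \<in> A \<Longrightarrow> x \<le> Sup A" by (auto simp: Sup_frame_coprod_def intro: le_Inf)
    show "(\<And>x. x \<in> A \<Longrightarrow> x \<le> z) \<Longrightarrow> Sup A \<le> z" by (auto simp: Sup_frame_coprod_def intro: Inf_le)
    show "Inf {} = (top :: ('a, 'b) frame_coprod)" by transfer simp
    show "Sup {} = (bot :: ('a, 'b) frame_coprod)"
      by (simp add: Sup_frame_coprod_def bot_frame_coprod_def)
  qed
qed

end

lemma coprod_ideal_imp:
  fixes I J :: "('a::frame \<times> 'b::frame) set"
  assumes I: "coprod_ideal I" and J: "coprod_ideal J"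
  shows "coprod_ideal {(a, b). \<forall>a' b'. a' \<le> a \<longrightarrow> b' \<le> b \<longrightarrow> (a', b') \<in> I \<longrightarrow> (a', b') \<in> J}"
    (is "coprod_ideal ?K")
  unfolding coprod_ideal_def
proof (intro conjI allI impI)
  fix a b a' b' assume "(a, b) \<in> ?K" "a' \<le> a" "b' \<le> b"
  then show "(a', b') \<in> ?K" by (auto intro: order_trans)
next
  fix S b assume S: "\<forall>a\<in>S. (a, b) \<in> ?K"
  have "(a', b') \<in> J" if a': "a' \<le> Sup S" and b': "b' \<le> b" and m: "(a', b') \<in> I" for a' b'
  proof -
    have "\<forall>s\<in>S. (inf a' s, b') \<in> J"
      using S b' coprod_ideal_down[OF I m] by simp
    then have "(Sup (inf a' ` S), b') \<in> J"
      by (auto intro!: coprod_ideal_Sup1[OF J])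
    then show ?thesis using a' by (simp add: inf_absorb1 flip: inf_Sup_frame)
  qed
  then show "(Sup S, b) \<in> ?K" by blast
next
  fix a T assume T: "\<forall>b\<in>T. (a, b) \<in> ?K"
  have "(a', b') \<in> J" if a': "a' \<le> a" and b': "b' \<le> Sup T" and m: "(a', b') \<in> I" for a' b'
  proof -
    have "\<forall>t\<in>T. (a', inf b' t) \<in> J"
      using T a' coprod_ideal_down[OF I m] by simp
    then have "(a', Sup (inf b' ` T)) \<in> J"
      by (auto intro!: coprod_ideal_Sup2[OF J])
    then show ?thesis using b' by (simp add: inf_absorb1 flip: inf_Sup_frame)
  qed
  then show "(a, Sup T) \<in> ?K" by blast
qed

lift_definition coprod_imp ::
    "('a::frame, 'b::frame) frame_coprod \<Rightarrow> ('a, 'b) frame_coprod \<Rightarrow> ('a, 'b) frame_coprod"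
  is "\<lambda>I J. {(a, b). \<forall>a' b'. a' \<le> a \<longrightarrow> b' \<le> b \<longrightarrow> (a', b') \<in> I \<longrightarrow> (a', b') \<in> J}"
  by (rule coprod_ideal_imp)

lemma le_coprod_imp_iff: "z \<le> coprod_imp x y \<longleftrightarrow> inf z x \<le> y"
proof (transfer, safe, goal_cases)
  case (2 z x y a b a' b')
  then show ?case by (blast intro: coprod_ideal_down)
qed blast

instance frame_coprod :: (frame, frame) frame
proof
  fix x :: "('a, 'b) frame_coprod" and Y
  show "inf x (Sup Y) = Sup (inf x ` Y)"
  proof (rule order_antisym)
    have "Sup Y \<le> coprod_imp x (Sup (inf x ` Y))"
      by (rule Sup_least) (auto simp: le_coprod_imp_iff inf_commute[of _ x] intro: Sup_upper)
    then show "inf x (Sup Y) \<le> Sup (inf x ` Y)" by (simp add: le_coprod_imp_iff inf_commute)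
    show "Sup (inf x ` Y) \<le> inf x (Sup Y)"
      by (auto intro!: Sup_least intro: le_infI2 Sup_upper)
  qed
qed

text \<open>The disjunct \<open>b = bot\<close> makes the set closed under the empty join in the second coordinate.\<close>

lift_definition inj1 :: "'a::frame \<Rightarrow> ('a, 'b::frame) frame_coprod"
  is "\<lambda>x. {(a, b). a \<le> x \<or> b = bot}"
  unfolding coprod_ideal_def
  by (auto simp: bot_unique Sup_le_iff intro: order_trans)

lift_definition inj2 :: "'b::frame \<Rightarrow> ('a::frame, 'b) frame_coprod"
  is "\<lambda>y. {(a, b). b \<le> y \<or> a = bot}"
  unfolding coprod_ideal_def
  by (auto simp: bot_unique Sup_le_iff intro: order_trans)

definition rect :: "'a::frame \<Rightarrow> 'b::frame \<Rightarrow> ('a, 'b) frame_coprod"  (infixl \<open>\<otimes>\<close> 75) where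
  "x \<otimes> y = inf (inj1 x) (inj2 y)"

text \<open>The projections of the product locale are given by \<^const>\<open>inj1\<close> and \<^const>\<open>inj2\<close>.\<close>

lemma inj_top: "inj1 top = top" "inj2 top = top"
  by (transfer, simp)+

lemma inj_inf: "inj1 (inf x y) = inf (inj1 x) (inj1 y)" "inj2 (inf x' y') = inf (inj2 x') (inj2 y')"
  by (transfer, auto)+

lemma frame_map_inj1: "frame_map (inj1 :: 'a::frame \<Rightarrow> ('a, 'b::frame) frame_coprod)"
proof -
  have "inj1 (Sup S) = Sup (inj1 ` S :: ('a, 'b) frame_coprod set)" for S
  proof (rule order_antisym)
    have "inj1 (Sup S) \<le> z" if "\<forall>s\<in>S. inj1 s \<le> z" for z :: "('a, 'b) frame_coprod"
      using that
    proof (transfer, safe, goal_cases)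
      case (1 S z a b)
      then have "(s, b) \<in> z" if "s \<in> S" for s using that by blast
      with 1 show ?case
        by (auto intro: coprod_ideal_down[OF _ coprod_ideal_Sup1])
    next
      case (2 S z a b)
      then show ?case by (simp add: coprod_ideal_bot2)
    qed
    then show "inj1 (Sup S) \<le> Sup (inj1 ` S :: ('a, 'b) frame_coprod set)" by (simp add: Sup_upper)
    have "inj1 s \<le> (inj1 t :: ('a, 'b) frame_coprod)" if "s \<le> t" for s t
      using that by transfer (auto intro: order_trans)
    then show "Sup (inj1 ` S :: ('a, 'b) frame_coprod set) \<le> inj1 (Sup S)"
      by (auto intro!: Sup_least intro: Sup_upper)
  qed
  then show ?thesis by (simp add: frame_map_iff inj_top inj_inf)
qed

lemma frame_map_inj2: "frame_map (inj2 :: 'b::frame \<Rightarrow> ('a::frame, 'b) frame_coprod)"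
proof -
  have "inj2 (Sup S) = Sup (inj2 ` S :: ('a, 'b) frame_coprod set)" for S
  proof (rule order_antisym)
    have "inj2 (Sup S) \<le> z" if "\<forall>s\<in>S. inj2 s \<le> z" for z :: "('a, 'b) frame_coprod"
      using that
    proof (transfer, safe, goal_cases)
      case (1 S z a b)
      then have "(a, s) \<in> z" if "s \<in> S" for s using that by blast
      with 1 show ?case
        by (auto intro: coprod_ideal_down[OF _ coprod_ideal_Sup2])
    next
      case (2 S z a b)
      then show ?case by (simp add: coprod_ideal_bot1)
    qed
    then show "inj2 (Sup S) \<le> Sup (inj2 ` S :: ('a, 'b) frame_coprod set)" by (simp add: Sup_upper)
    have "inj2 s \<le> (inj2 t :: ('a, 'b) frame_coprod)" if "s \<le> t" for s t
      using that by transfer (auto intro: order_trans)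
    then show "Sup (inj2 ` S :: ('a, 'b) frame_coprod set) \<le> inj2 (Sup S)"
      by (auto intro!: Sup_least intro: Sup_upper)
  qed
  then show ?thesis by (simp add: frame_map_iff inj_top inj_inf)
qed

lift_definition in_coprod :: "'a::frame \<times> 'b::frame \<Rightarrow> ('a, 'b) frame_coprod \<Rightarrow> bool" is "(\<in>)" .

lemma rect_le_iff: "a \<otimes> b \<le> z \<longleftrightarrow> in_coprod (a, b) z"
  unfolding rect_def
proof (transfer, goal_cases)
  case (1 a b z)
  then show ?case
    by (auto intro: coprod_ideal_down coprod_ideal_bot1 coprod_ideal_bot2)
qed

lemma coprod_le_iff: "z \<le> w \<longleftrightarrow> (\<forall>a b. in_coprod (a, b) z \<longrightarrow> in_coprod (a, b) w)"
  by transfer auto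

lemma coprod_eq_Sup_rect: "z = Sup {a \<otimes> b | a b. a \<otimes> b \<le> z}"
proof (rule order_antisym)
  have "in_coprod (a, b) (Sup {a \<otimes> b | a b. a \<otimes> b \<le> z})" if "in_coprod (a, b) z" for a b
  proof -
    have "a \<otimes> b \<le> z" using that by (simp only: rect_le_iff)
    then have "a \<otimes> b \<le> Sup {a \<otimes> b | a b. a \<otimes> b \<le> z}" by (intro Sup_upper) blast
    then show ?thesis by (simp only: rect_le_iff)
  qed
  then show "z \<le> Sup {a \<otimes> b | a b. a \<otimes> b \<le> z}"
    unfolding coprod_le_iff[of z] by blast
  show "Sup {a \<otimes> b | a b. a \<otimes> b \<le> z} \<le> z" by (auto intro: Sup_least)
qed

lemma rect_inf: "inf (a \<otimes> b) (c \<otimes> d) = inf a c \<otimes> inf b d"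
  unfolding rect_def inj_inf by (simp add: inf_aci)

lemma inf_Sup_Sup_frame: "inf (Sup A) (Sup B) = Sup {inf a b | a b. a \<in> A \<and> b \<in> B}"
  for A B :: "'a::frame set"
proof (rule order_antisym)
  have "inf (Sup A) b \<le> Sup {inf a b | a b. a \<in> A \<and> b \<in> B}" if "b \<in> B" for b
  proof -
    have "inf (Sup A) b = Sup (inf b ` A)"
      by (simp add: inf_commute[of "Sup A"] inf_Sup_frame)
    also have "\<dots> \<le> Sup {inf a b | a b. a \<in> A \<and> b \<in> B}"
      using that by (intro Sup_subset_mono) (auto simp: inf_commute)
    finally show ?thesis .
  qed
  then show "inf (Sup A) (Sup B) \<le> Sup {inf a b | a b. a \<in> A \<and> b \<in> B}"
    unfolding inf_Sup_frame by (auto intro: Sup_least)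
  show "Sup {inf a b | a b. a \<in> A \<and> b \<in> B} \<le> inf (Sup A) (Sup B)"
    by (auto intro!: Sup_least intro: le_infI1 le_infI2 Sup_upper)
qed

lemma frame_map_mono: "frame_map f \<Longrightarrow> x \<le> y \<Longrightarrow> f x \<le> f y"
  for f :: "'a::complete_lattice \<Rightarrow> 'b::complete_lattice"
  by (metis frame_map_iff inf.absorb_iff2 inf_commute)

theorem coprod_universal:
  fixes f :: "'a::frame \<Rightarrow> 'c::frame" and g :: "'b::frame \<Rightarrow> 'c"
  assumes f: "frame_map f" and g: "frame_map g"
  shows "\<exists>!h. frame_map h \<and> (\<forall>x. h (inj1 x) = f x) \<and> (\<forall>y. h (inj2 y) = g y)"
proof (rule ex_ex1I)
  define h where "h z = Sup {inf (f a) (g b) | a b. in_coprod (a, b) z}" for z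
  have fS: "f (Sup S) = Sup (f ` S)" and gS: "g (Sup T) = Sup (g ` T)" for S T
    using f g by (simp_all add: frame_map_iff)
  have ideal: "coprod_ideal {(a, b). inf (f a) (g b) \<le> c}" for c
    unfolding coprod_ideal_def
  proof (intro conjI allI impI)
    fix a b a' b' assume ab: "(a, b) \<in> {(a, b). inf (f a) (g b) \<le> c}" and "a' \<le> a" "b' \<le> b"
    then have "inf (f a') (g b') \<le> inf (f a) (g b)"
      by (intro inf_mono frame_map_mono[OF f] frame_map_mono[OF g])
    also have "\<dots> \<le> c" using ab by simp
    finally show "(a', b') \<in> {(a, b). inf (f a) (g b) \<le> c}" by simp
  next
    fix S b assume "\<forall>a\<in>S. (a, b) \<in> {(a, b). inf (f a) (g b) \<le> c}"
    then show "(Sup S, b) \<in> {(a, b). inf (f a) (g b) \<le> c}"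
      by (auto simp: fS inf_commute[of "Sup _"] inf_Sup_frame Sup_le_iff) (auto simp: inf_commute)
  next
    fix a T assume "\<forall>b\<in>T. (a, b) \<in> {(a, b). inf (f a) (g b) \<le> c}"
    then show "(a, Sup T) \<in> {(a, b). inf (f a) (g b) \<le> c}"
      by (auto simp: gS inf_Sup_frame Sup_le_iff)
  qed
  define k where "k c = Abs_frame_coprod {(a, b). inf (f a) (g b) \<le> c}" for c
  have in_k: "in_coprod (a, b) (k c) \<longleftrightarrow> inf (f a) (g b) \<le> c" for a b c
    by (simp add: k_def in_coprod.rep_eq Abs_frame_coprod_inverse ideal)
  have adj: "h z \<le> c \<longleftrightarrow> z \<le> k c" for z c
    by (auto simp: h_def Sup_le_iff coprod_le_iff in_k)
  have hS: "h (Sup Z) = Sup (h ` Z)" for Z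
  proof (rule order_antisym)
    show "h (Sup Z) \<le> Sup (h ` Z)"
      unfolding adj by (rule Sup_least) (auto simp flip: adj intro: Sup_upper)
    show "Sup (h ` Z) \<le> h (Sup Z)"
      by (rule Sup_least) (auto simp: adj, metis Sup_upper adj order_refl order_trans)
  qed
  have h_rect: "h (a \<otimes> b) = inf (f a) (g b)" for a b
    by (rule order_antisym) (simp_all add: adj rect_le_iff in_k, auto simp: h_def simp flip: rect_le_iff intro: Sup_upper)
  have mono: "h z \<le> h w" if "z \<le> w" for z w
    using that adj order_trans by blast
  have h_inf: "h (inf z w) = inf (h z) (h w)" for z w
  proof (rule order_antisym)
    have "inf (inf (f a) (g b)) (inf (f c) (g d)) \<le> h (inf z w)"
      if "in_coprod (a, b) z" "in_coprod (c, d) w" for a b c d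
    proof -
      have "inf (a \<otimes> b) (c \<otimes> d) \<le> inf z w"
        using that by (auto simp flip: rect_le_iff intro: le_infI1 le_infI2)
      from mono[OF this] have "inf (f (inf a c)) (g (inf b d)) \<le> h (inf z w)"
        by (simp add: rect_inf h_rect)
      then show ?thesis
        using f g by (simp add: frame_map_iff inf_aci)
    qed
    then show "inf (h z) (h w) \<le> h (inf z w)"
      unfolding h_def[of z] h_def[of w] inf_Sup_Sup_frame by (auto intro!: Sup_least)
    show "h (inf z w) \<le> inf (h z) (h w)" by (simp add: mono)
  qed
  have h1: "h (inj1 x) = f x" and h2: "h (inj2 y) = g y" for x y
    using h_rect[of x top] h_rect[of top y] f g by (simp_all add: rect_def inj_top frame_map_iff)
  have "h top = top" using h1[of top] f by (simp add: inj_top frame_map_iff)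
  then have "frame_map h" using h_inf hS by (simp add: frame_map_iff)
  with h1 h2 show "\<exists>h. frame_map h \<and> (\<forall>x. h (inj1 x) = f x) \<and> (\<forall>y. h (inj2 y) = g y)" by blast
next
  fix h h' :: "('a, 'b) frame_coprod \<Rightarrow> 'c"
  assume h: "frame_map h \<and> (\<forall>x. h (inj1 x) = f x) \<and> (\<forall>y. h (inj2 y) = g y)"
    and h': "frame_map h' \<and> (\<forall>x. h' (inj1 x) = f x) \<and> (\<forall>y. h' (inj2 y) = g y)"
  have "h (a \<otimes> b) = h' (a \<otimes> b)" for a b
    using h h' by (simp add: rect_def frame_map_iff)
  then have "h ` {a \<otimes> b | a b. a \<otimes> b \<le> z} = h' ` {a \<otimes> b | a b. a \<otimes> b \<le> z}" for z
    by (intro image_cong) auto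
  moreover have "h (Sup Z) = Sup (h ` Z)" "h' (Sup Z) = Sup (h' ` Z)" for Z
    using h h' by (simp_all add: frame_map_iff)
  ultimately have "h (Sup {a \<otimes> b | a b. a \<otimes> b \<le> z}) = h' (Sup {a \<otimes> b | a b. a \<otimes> b \<le> z})" for z
    by simp
  then have "h z = h' z" for z by (simp flip: coprod_eq_Sup_rect)
  then show "h = h'" by blast
qed


section \<open>Sublocales\<close>

text \<open>
  A sublocale of the locale with frame \<open>'x\<close> is given by a carrier \<open>A\<close> with a surjective frame map
  \<open>i\<close> from \<open>'x\<close> onto \<open>A\<close>. A factorisation of the inclusion of the first sublocale through that of
  the second is, on frames, a factorisation \<open>i = h \<circ> j\<close>.
\<close>

definition sublocale_on :: "'r::order set \<Rightarrow> ('x::frame \<Rightarrow> 'r) \<Rightarrow> bool" where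
  "sublocale_on A i \<longleftrightarrow> frame_map_on UNIV A i \<and> i ` UNIV = A"

definition sublocale_le ::
    "'r::order set \<Rightarrow> ('x::frame \<Rightarrow> 'r) \<Rightarrow> 's::order set \<Rightarrow> ('x \<Rightarrow> 's) \<Rightarrow> bool" where
  "sublocale_le A i B j \<longleftrightarrow> (\<exists>h. frame_map_on B A h \<and> i = h \<circ> j)"


section \<open>Localic relations with open cones\<close>

definition localic_relation :: "(('a::frame, 'a) frame_coprod \<Rightarrow> 'r::frame) \<Rightarrow> bool" where
  "localic_relation r \<longleftrightarrow> sublocale_on UNIV r"

text \<open>The frame maps \<open>s\<^sup>-\<^sup>1\<close> and \<open>t\<^sup>-\<^sup>1\<close> of the source and target maps.\<close>

definition source_map :: "(('a::frame, 'a) frame_coprod \<Rightarrow> 'r::frame) \<Rightarrow> 'a \<Rightarrow> 'r" where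
  "source_map r = r \<circ> inj1"

definition target_map :: "(('a::frame, 'a) frame_coprod \<Rightarrow> 'r::frame) \<Rightarrow> 'a \<Rightarrow> 'r" where
  "target_map r = r \<circ> inj2"

definition is_left_adjoint :: "('b::order \<Rightarrow> 'a::order) \<Rightarrow> ('a \<Rightarrow> 'b) \<Rightarrow> bool" where
  "is_left_adjoint g f \<longleftrightarrow> (\<forall>x y. g x \<le> y \<longleftrightarrow> x \<le> f y)"

definition left_adjoint :: "('a::order \<Rightarrow> 'b::order) \<Rightarrow> 'b \<Rightarrow> 'a" where
  "left_adjoint f = (THE g. is_left_adjoint g f)"

lemma left_adjoint_eq: "is_left_adjoint g f \<Longrightarrow> left_adjoint f = g"
  unfolding left_adjoint_def
proof (rule the_equality)
  fix g' assume g: "is_left_adjoint g f" and g': "is_left_adjoint g' f"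
  have "g' x \<le> g x" "g x \<le> g' x" for x
    using g g' unfolding is_left_adjoint_def by blast+
  then show "g' = g" by (auto intro: order_antisym)
qed

text \<open>Openness of a locale map, stated for its frame map.\<close>

definition open_locale_map :: "('a::frame \<Rightarrow> 'b::frame) \<Rightarrow> bool" where
  "open_locale_map f \<longleftrightarrow>
     frame_map f \<and> (\<exists>g. is_left_adjoint g f \<and> (\<forall>x y. g (inf x (f y)) = inf (g x) y))"

definition has_open_cones :: "(('a::frame, 'a) frame_coprod \<Rightarrow> 'r::frame) \<Rightarrow> bool" where
  "has_open_cones r \<longleftrightarrow> open_locale_map (source_map r) \<and> open_locale_map (target_map r)"

definition up_cone :: "(('a::frame, 'a) frame_coprod \<Rightarrow> 'r::frame) \<Rightarrow> 'a \<Rightarrow> 'a" where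
  "up_cone r = left_adjoint (target_map r) \<circ> source_map r"

definition down_cone :: "(('a::frame, 'a) frame_coprod \<Rightarrow> 'r::frame) \<Rightarrow> 'a \<Rightarrow> 'a" where
  "down_cone r = left_adjoint (source_map r) \<circ> target_map r"


section \<open>Parallel pairs and the induced relation\<close>

definition join_preserving :: "('a::complete_lattice \<Rightarrow> 'b::complete_lattice) \<Rightarrow> bool" where
  "join_preserving f \<longleftrightarrow> (\<forall>S. f (Sup S) = Sup (f ` S))"

definition parallel :: "('a::frame \<Rightarrow> 'a) \<Rightarrow> ('a \<Rightarrow> 'a) \<Rightarrow> bool" where
  "parallel u d \<longleftrightarrow>
     (\<forall>x y. inf (u x) y \<le> u (inf x (d y)) \<and> inf x (d y) \<le> d (inf (u x) y))"

definition rect_rel ::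
    "('a::frame \<Rightarrow> 'a) \<Rightarrow> ('a \<Rightarrow> 'a) \<Rightarrow> ('a, 'a) frame_coprod \<Rightarrow> ('a, 'a) frame_coprod \<Rightarrow> bool" where
  "rect_rel u d p q \<longleftrightarrow>
     (\<exists>a b a' b'. p = a \<otimes> b \<and> q = a' \<otimes> b' \<and>
        inf (u a) b = inf (u a') b' \<and> inf a (d b) = inf a' (d b'))"

definition saturated ::
    "('a::frame \<Rightarrow> 'a) \<Rightarrow> ('a \<Rightarrow> 'a) \<Rightarrow> ('a, 'a) frame_coprod set" where
  "saturated u d = {z. \<forall>p q. rect_rel u d p q \<longrightarrow> (\<forall>w. inf p w \<le> z \<longleftrightarrow> inf q w \<le> z)}"

definition saturate ::
    "('a::frame \<Rightarrow> 'a) \<Rightarrow> ('a \<Rightarrow> 'a) \<Rightarrow> ('a, 'a) frame_coprod \<Rightarrow> ('a, 'a) frame_coprod" where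
  "saturate u d z = (LEAST y. y \<in> saturated u d \<and> z \<le> y)"

lemma saturated_Inf: "Z \<subseteq> saturated u d \<Longrightarrow> Inf Z \<in> saturated u d"
  unfolding saturated_def subset_eq mem_Collect_eq le_Inf_iff by blast

lemma saturated_imp: "z \<in> saturated u d \<Longrightarrow> coprod_imp w z \<in> saturated u d"
  unfolding saturated_def by (simp add: le_coprod_imp_iff inf_assoc)

lemma saturate_eq: "saturate u d z = Inf {y \<in> saturated u d. z \<le> y}"
  unfolding saturate_def
  by (rule Least_equality) (auto simp: le_Inf_iff intro!: saturated_Inf Inf_lower)

lemma saturate_in: "saturate u d z \<in> saturated u d"
  unfolding saturate_eq by (auto intro!: saturated_Inf)

lemma saturate_le_iff: "y \<in> saturated u d \<Longrightarrow> saturate u d z \<le> y \<longleftrightarrow> z \<le> y"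
proof
  assume "saturate u d z \<le> y"
  moreover have "z \<le> saturate u d z" unfolding saturate_eq by (auto intro: Inf_greatest)
  ultimately show "z \<le> y" by (rule order_trans[rotated])
qed (auto simp: saturate_eq intro: Inf_lower)

lemma saturate_inf: "saturate u d (inf y z) = inf (saturate u d y) (saturate u d z)"
proof (rule order_antisym)
  have up: "z \<le> saturate u d z" for z
    using saturate_in saturate_le_iff by blast
  have "saturate u d x \<le> saturate u d y" if "x \<le> y" for x y
    using that up order_trans by (blast intro: saturate_le_iff[OF saturate_in, THEN iffD2])
  then show "saturate u d (inf y z) \<le> inf (saturate u d y) (saturate u d z)" by simp
  let ?c = "saturate u d (inf y z)"
  have "y \<le> coprod_imp z ?c" by (simp add: le_coprod_imp_iff up)
  then have "saturate u d y \<le> coprod_imp z ?c"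
    by (simp add: saturate_le_iff saturated_imp saturate_in)
  then have "z \<le> coprod_imp (saturate u d y) ?c" by (simp add: le_coprod_imp_iff inf_commute)
  then have "saturate u d z \<le> coprod_imp (saturate u d y) ?c"
    by (simp add: saturate_le_iff saturated_imp saturate_in)
  then show "inf (saturate u d y) (saturate u d z) \<le> ?c"
    by (simp add: le_coprod_imp_iff inf_commute)
qed

lemma sublocale_saturate: "sublocale_on (saturated u d) (saturate u d)"
proof -
  have id: "saturate u d y = y" if "y \<in> saturated u d" for y
    using that by (auto simp: saturate_eq intro!: order_antisym Inf_lower Inf_greatest)
  have "isGlb (saturated u d) (saturate u d ` S) (saturate u d (Inf S))" if "finite S" for S
  proof -
    have "saturate u d (Inf S) = Inf (saturate u d ` S)"
      using that
      by (induction S rule: finite_induct)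
        (simp_all add: saturate_inf id[OF saturated_Inf[of "{}", simplified]])
    then show ?thesis using saturate_in[of u d "Inf S"] by (simp add: isGlb_iff_le le_Inf_iff)
  qed
  moreover have "isLub (saturated u d) (saturate u d ` S) (saturate u d (Sup S))" for S
    by (auto simp: isLub_iff_le saturate_in saturate_le_iff Sup_le_iff)
  moreover have "range (saturate u d) = saturated u d"
    using saturate_in id by (auto simp: image_iff) metis
  ultimately show ?thesis
    by (auto simp: sublocale_on_def frame_map_on_def isLub_UNIV_iff isGlb_UNIV_iff)
qed

end

(* The relation R is contained in the relation induced by (u, d) iff r identifies any two related
   rectangles: then the right adjoint of r takes values in the saturated elements, so r does not
   distinguish an element from its saturation. On rectangles, r (a \<otimes> b) is the meet of
   s\<^sup>-\<^sup>1 a and t\<^sup>-\<^sup>1 b, and the cone inequalities say s\<^sup>-\<^sup>1 a \<le> t\<^sup>-\<^sup>1 (u a) and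
   t\<^sup>-\<^sup>1 b \<le> s\<^sup>-\<^sup>1 (d b). Hence r (a \<otimes> b) = r (inf a (d b) \<otimes> inf (u a) b), which depends only on
   the class of a \<otimes> b. Conversely, parallelism makes a \<otimes> top related to a \<otimes> u a, and top \<otimes> b
   related to d b \<otimes> b, which gives back the cone inequalities. *)

theory Submission
  imports Defs
begin

lemma join_preserving_mono:
  fixes f :: "'a::complete_lattice \<Rightarrow> 'b::complete_lattice"
  shows "join_preserving f \<Longrightarrow> mono f"
proof (rule monoI)
  fix x y :: 'a
  assume f: "join_preserving f" and "x \<le> y"
  then have "f (Sup {x, y}) = Sup (f ` {x, y})" unfolding join_preserving_def by blast
  with \<open>x \<le> y\<close> show "f x \<le> f y" by (simp add: sup_absorb2 le_iff_sup)
qed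

lemma frame_map_rect:
  "frame_map r \<Longrightarrow> r (a \<otimes> b) = inf (source_map r a) (target_map r b)"
  by (simp add: rect_def source_map_def target_map_def frame_map_iff)

text \<open>Preservation of joins makes \<open>c \<mapsto> Sup {x. f x \<le> c}\<close> the right
  adjoint of \<open>f\<close>.\<close>

lemma frame_map_le_Sup_iff:
  fixes f :: "'a::complete_lattice \<Rightarrow> 'b::complete_lattice"
  assumes "frame_map f"
  shows "z \<le> Sup {x. f x \<le> c} \<longleftrightarrow> f z \<le> c"
proof
  assume "z \<le> Sup {x. f x \<le> c}"
  then have "f z \<le> f (Sup {x. f x \<le> c})" by (rule frame_map_mono[OF assms])
  also have "\<dots> = Sup (f ` {x. f x \<le> c})" using assms by (simp add: frame_map_iff)
  also have "\<dots> \<le> c" by (auto intro: Sup_least)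
  finally show "f z \<le> c" .
qed (simp add: Sup_upper)

lemma le_saturate: "z \<le> saturate u d z"
  using saturate_le_iff[OF saturate_in] by blast

text \<open>Testing saturation with \<open>w = top\<close> shows that \<open>p\<close> and
  \<open>q\<close> have the same saturated upper bounds.\<close>

lemma saturate_rect_rel:
  assumes "rect_rel u d p q"
  shows "saturate u d p = saturate u d q"
proof -
  have "p \<le> y \<longleftrightarrow> q \<le> y" if "y \<in> saturated u d" for y
  proof -
    have "inf p top \<le> y \<longleftrightarrow> inf q top \<le> y"
      using that assms unfolding saturated_def by blast
    then show ?thesis by simp
  qed
  then have "{y \<in> saturated u d. p \<le> y} = {y \<in> saturated u d. q \<le> y}" by blast
  then show ?thesis by (simp add: saturate_eq)
qed

lemma frame_map_saturate:
  fixes r :: "('a::frame, 'a) frame_coprod \<Rightarrow> 'r::frame"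
  assumes r: "frame_map r" and eq: "\<And>p q. rect_rel u d p q \<Longrightarrow> r p = r q"
  shows "r (saturate u d z) = r z"
proof (rule order_antisym)
  have inf: "r (inf x y) = inf (r x) (r y)" for x y using r by (simp add: frame_map_iff)
  \<comment> \<open>By adjointness, \<open>inf p w\<close> lies below this element iff
    \<open>inf (r p) (r w) \<le> r z\<close>, a condition that sees \<open>p\<close> only through
    \<open>r p\<close>.\<close>
  have "Sup {x. r x \<le> r z} \<in> saturated u d"
    by (simp add: saturated_def frame_map_le_Sup_iff[OF r] inf eq)
  then have "saturate u d z \<le> Sup {x. r x \<le> r z}"
    by (subst saturate_le_iff) (simp_all add: frame_map_le_Sup_iff[OF r])
  then show "r (saturate u d z) \<le> r z" by (simp add: frame_map_le_Sup_iff[OF r])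
qed (rule frame_map_mono[OF r le_saturate])

text \<open>For the converse, the factor through \<open>saturate u d\<close> is \<open>r\<close>
  itself, restricted to the saturated elements.\<close>

lemma sublocale_le_saturated_iff:
  fixes r :: "('a::frame, 'a) frame_coprod \<Rightarrow> 'r::frame"
  assumes r: "frame_map r"
  shows "sublocale_le UNIV r (saturated u d) (saturate u d) \<longleftrightarrow>
    (\<forall>p q. rect_rel u d p q \<longrightarrow> r p = r q)"
proof
  assume "sublocale_le UNIV r (saturated u d) (saturate u d)"
  then show "\<forall>p q. rect_rel u d p q \<longrightarrow> r p = r q"
    unfolding sublocale_le_def by (metis comp_apply saturate_rect_rel)
next
  assume "\<forall>p q. rect_rel u d p q \<longrightarrow> r p = r q"
  then have sat: "r (saturate u d z) = r z" for z by (intro frame_map_saturate[OF r]) blast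
  have "frame_map_on (saturated u d) UNIV r"
    unfolding frame_map_on_def
  proof (intro conjI allI impI)
    fix S x assume "isLub (saturated u d) S x"
    then have x: "x \<in> saturated u d" "\<And>y. y \<in> saturated u d \<Longrightarrow> x \<le> y \<longleftrightarrow> Sup S \<le> y"
      by (auto simp: isLub_iff_le Sup_le_iff)
    \<comment> \<open>Joins of saturated elements are saturations of ambient joins, and
      \<open>r\<close> does not see the saturation.\<close>
    have "x = saturate u d (Sup S)"
    proof (rule order_antisym)
      show "x \<le> saturate u d (Sup S)" using x(2)[OF saturate_in] le_saturate by blast
      show "saturate u d (Sup S) \<le> x" using x(2)[OF x(1)] saturate_le_iff[OF x(1)] by blast
    qed
    then show "isLub UNIV (r ` S) (r x)"
      using r by (simp add: isLub_UNIV_iff sat frame_map_iff)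
  next
    fix S x assume S: "S \<subseteq> saturated u d" "finite S" and "isGlb (saturated u d) S x"
    then have "x \<in> saturated u d" "\<And>y. y \<in> saturated u d \<Longrightarrow> y \<le> x \<longleftrightarrow> y \<le> Inf S"
      by (auto simp: isGlb_iff_le le_Inf_iff)
    \<comment> \<open>Meets, in contrast, are the ambient ones.\<close>
    then have "x = Inf S"
      using saturated_Inf[OF S(1)] by (intro order_antisym) blast+
    then show "isGlb UNIV (r ` S) (r x)"
      using r S(2) by (simp add: frame_map_on_def isGlb_UNIV_iff)
  qed simp
  moreover have "r = r \<circ> saturate u d" by (simp add: fun_eq_iff sat)
  ultimately show "sublocale_le UNIV r (saturated u d) (saturate u d)"
    unfolding sublocale_le_def by blast
qed

lemma open_left_adjoint_le_iff:
  "open_locale_map f \<Longrightarrow> left_adjoint f x \<le> y \<longleftrightarrow> x \<le> f y"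
  unfolding open_locale_map_def using left_adjoint_eq is_left_adjoint_def by metis

text \<open>Transposing along the left adjoint of \<open>target_map r\<close> turns the bound on the
  cone into one between frame maps.\<close>

lemma up_cone_le_iff:
  "has_open_cones r \<Longrightarrow> up_cone r \<le> u \<longleftrightarrow> (\<forall>a. source_map r a \<le> target_map r (u a))"
  by (simp add: up_cone_def le_fun_def open_left_adjoint_le_iff has_open_cones_def)

lemma down_cone_le_iff:
  "has_open_cones r \<Longrightarrow> down_cone r \<le> d \<longleftrightarrow> (\<forall>b. target_map r b \<le> source_map r (d b))"
  by (simp add: down_cone_def le_fun_def open_left_adjoint_le_iff has_open_cones_def)

text \<open>The \<open>u\<close> components are both \<open>u a\<close>. For the \<open>d\<close>
  components, the second parallel law at \<open>y = top\<close> gives one inequality and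
  monotonicity of \<open>d\<close> the other.\<close>

lemma rect_rel_up:
  assumes "parallel u d" "mono d"
  shows "rect_rel u d (a \<otimes> top) (a \<otimes> u a)"
proof -
  have "inf a (d top) \<le> d (u a)"
    using assms(1)[unfolded parallel_def, rule_format, of a top] by simp
  moreover have "d (u a) \<le> d top" by (rule monoD[OF assms(2) top_greatest])
  ultimately have "inf a (d top) = inf a (d (u a))"
    by (intro order_antisym) (auto intro: le_infI2)
  then show ?thesis unfolding rect_rel_def by force
qed

text \<open>Dual to \<open>rect_rel_up\<close>, by the first parallel law at
  \<open>x = top\<close>.\<close>

lemma rect_rel_down:
  assumes "parallel u d" "mono u"
  shows "rect_rel u d (top \<otimes> b) (d b \<otimes> b)"
proof -
  have "inf (u top) b \<le> u (d b)"
    using assms(1)[unfolded parallel_def, rule_format, of top b] by simp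
  moreover have "u (d b) \<le> u top" by (rule monoD[OF assms(2) top_greatest])
  ultimately have "inf (u top) b = inf (u (d b)) b"
    by (intro order_antisym) (auto intro: le_infI1)
  then show ?thesis unfolding rect_rel_def by force
qed

lemma rect_rel_imp_eq:
  fixes r :: "('a::frame, 'a) frame_coprod \<Rightarrow> 'r::frame"
  assumes r: "frame_map r" and s: "frame_map (source_map r)" and t: "frame_map (target_map r)"
    and up: "\<And>a. source_map r a \<le> target_map r (u a)"
    and down: "\<And>b. target_map r b \<le> source_map r (d b)"
    and "rect_rel u d p q"
  shows "r p = r q"
proof -
  \<comment> \<open>The two arguments on the right are exactly the meets that
    \<open>rect_rel\<close> compares.\<close>
  have "r (a \<otimes> b) = inf (source_map r (inf a (d b))) (target_map r (inf (u a) b))" for a b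
  proof -
    have "inf (source_map r (inf a (d b))) (target_map r (inf (u a) b)) =
        inf (inf (source_map r a) (target_map r (u a))) (inf (target_map r b) (source_map r (d b)))"
      using s t by (simp add: frame_map_iff inf_aci)
    also have "\<dots> = r (a \<otimes> b)"
      by (simp add: frame_map_rect[OF r] inf_absorb1 up down)
    finally show ?thesis by simp
  qed
  then show ?thesis using \<open>rect_rel u d p q\<close> unfolding rect_rel_def by metis
qed

theorem corollary8p5:
  fixes r :: "('a::frame, 'a) frame_coprod \<Rightarrow> 'r::frame"
    and u d :: "'a \<Rightarrow> 'a"
  assumes "localic_relation r"
    and "has_open_cones r"
    and "join_preserving u"
    and "join_preserving d"
    and "parallel u d"
  shows "sublocale_le UNIV r (saturated u d) (saturate u d) \<longleftrightarrow> up_cone r \<le> u \<and> down_cone r \<le> d"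
proof -
  have r: "frame_map r"
    using assms(1) by (simp add: localic_relation_def sublocale_on_def)
  have s: "frame_map (source_map r)" and t: "frame_map (target_map r)"
    using assms(2) by (simp_all add: has_open_cones_def open_locale_map_def)
  have top: "source_map r top = top" "target_map r top = top"
    using s t by (simp_all add: frame_map_iff)
  show ?thesis
    unfolding sublocale_le_saturated_iff[OF r] up_cone_le_iff[OF assms(2)]
      down_cone_le_iff[OF assms(2)]
  proof (intro iffI conjI allI impI)
    assume eq: "\<forall>p q. rect_rel u d p q \<longrightarrow> r p = r q"
    fix a
    have "r (a \<otimes> top) = r (a \<otimes> u a)" "r (top \<otimes> a) = r (d a \<otimes> a)"
      using eq assms(3-5) by (simp_all add: rect_rel_up rect_rel_down join_preserving_mono)
    \<comment> \<open>The factors at \<open>top\<close> vanish, so each equation exhibits one side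
      of a cone inequality as a meet with the other.\<close>
    then have "source_map r a = inf (source_map r a) (target_map r (u a))"
      "target_map r a = inf (source_map r (d a)) (target_map r a)"
      by (simp_all add: frame_map_rect[OF r] top)
    then show "source_map r a \<le> target_map r (u a)" "target_map r a \<le> source_map r (d a)"
      by (metis inf_le2, metis inf_le1)
  next
    fix p q
    assume "(\<forall>a. source_map r a \<le> target_map r (u a)) \<and>
        (\<forall>b. target_map r b \<le> source_map r (d b))"
      and "rect_rel u d p q"
    then show "r p = r q" using rect_rel_imp_eq[OF r s t] by blast
  qed
qed

end
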